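(* Let $k\ge 4$, let $\tau:\mathbb{Z}/k\mathbb{Z}\to\mathcal{C}_k$ be a faithful representation, where $\mathcal{C}_k\subset O(\mathbb{R}^2)$ is the group generated by the rotation by $2\pi/k$ about the origin, let $(H,\psi)$ be a finite $\mathbb{Z}/k\mathbb{Z}$-gain graph, let $\tilde p:V(H)\to\mathbb{R}^2$ be $\mathcal{C}_k$-regular, and let $j$ be an odd integer with $1\le j<k$. If $O_j(H,\psi,\tilde p)$ is row independent, then $F$ is $(2,3,2)$-gain-sparse for every $F\subseteq E(H)$ such that $\langle F\rangle$ is isomorphic to $\mathbb{Z}/2\mathbb{Z}$.
   Context: A $\Gamma$-gain graph $(H,\psi)$ is a directed multigraph $H$ (loops and parallel edges allowed) with a map $\psi:E(H)\to\Gamma$; the orientation is only a reference, reversing an edge inverts its gain. Here $\Gamma=\mathbb{Z}/k\mathbb{Z}$. The gain $\psi(C)$ of a cycle $C$ (a loop is a cycle, two parallel edges form a cycle) is the product (sum, in additive notation) of its edge gains along the cycle, inverted for edges traversed backwards. For $F\subseteq E(H)$, $\langle F\rangle$ is the subgroup of $\Gamma$ generated by the gains of all cycles in the subgraph induced by the edge set $F$. $F$ is balanced if every cycle in $F$ has identity gain. $V(F)$ is the set of endpoints of edges in $F$. An edge set $E$ is $(2,3,2)$-gain-sparse if $|F'|\le 2|V(F')|-3$ for every nonempty balanced $F'\subseteq E$ and $|F'|\le 2|V(F')|-2$ for every nonempty $F'\subseteq E$. Orbit rigidity matrix $O_j(H,\psi,\tilde p)$: with $\omega=e^{2\pi\sqrt{-1}/k}$,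 it is the $|E(H)|\times 2|V(H)|$ complex matrix whose row for $\tilde e=(\tilde u,\tilde v)$ has $(\tilde p(\tilde u)-\tau(\psi(\tilde e))\tilde p(\tilde v))^\top$ in the two columns of $\tilde u$, $\omega^{j\psi(\tilde e)}(\tilde p(\tilde v)-\tau(\psi(\tilde e))^{-1}\tilde p(\tilde u))^\top$ in the two columns of $\tilde v$, and $0$ elsewhere; for a loop at $\tilde v$ the entries in the columns of $\tilde v$ are the sum of these two vectors. Row independent means the rows are linearly independent. Regularity: the covering graph $G$ of $(H,\psi)$ has vertex set $\Gamma\times V(H)$ (write $gv$ for $(g,v)$) and edges $\{g\tilde u,g\psi(\tilde e)\tilde v\}$ for $\tilde e=(\tilde u,\tilde v)\in E(H)$, $g\in\Gamma$. A map $\tilde p:V(H)\to\mathbb{R}^2$ determines $p:V(G)\to\mathbb{R}^2$ by $p(g\tilde v)=\tau(g)\tilde p(\tilde v)$. The rigidity matrix $R(G,p)$ has, for each edge $\{u,v\}$ of $G$, a row with $(p(u)-p(v))^\top$ in the columns of $u$, $(p(v)-p(u))^\top$ in the columns of $v$, and $0$ elsewhere (degenerate edges with both ends equal contribute a zero row). $\tilde p$ is $\mathcal{C}_k$-regular if $\operatorname{rank}R(G,p)$ is maximal among all maps $p$ arising in this way from maps $V(H)\to\mathbb{R}^2$. *)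

theory Defs
  imports
    "HOL-Analysis.Analysis"
    "HOL-Library.Function_Algebras"
    "HOL-Algebra.Elementary_Groups"
    "Graph_Theory.Arc_Walk"
begin

section \<open>Matrices with finite sets of rows and columns\<close>

text \<open>
  The sizes of the matrices below depend on the graph, so a matrix is a map from row indices to
  rows, and a row is a function of the column index. Only the rows from an explicitly given index
  set count. All columns outside the relevant column set are zero in these rows.
\<close>

interpretation row_space: vector_space "\<lambda>(c::'f::field) (r::'c \<Rightarrow> 'f) x. c * r x"
  by unfold_locales (auto simp: fun_eq_iff algebra_simps)

definition matrix_rank :: "'r set \<Rightarrow> ('r \<Rightarrow> 'c \<Rightarrow> 'f::field) \<Rightarrow> nat" where
  "matrix_rank R M = row_space.dim (M ` R)"

text \<open>The rows are independent as an indexed family, so equal rows with different indices are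
  dependent.\<close>

definition row_independent :: "'r set \<Rightarrow> ('r \<Rightarrow> 'c \<Rightarrow> 'f::field) \<Rightarrow> bool" where
  "row_independent R M \<longleftrightarrow> inj_on M R \<and> row_space.independent (M ` R)"

section \<open>Gain graphs\<close>

definition finite_gain_graph ::
    "('g, 'm) monoid_scheme \<Rightarrow> ('v, 'e) pre_digraph \<Rightarrow> ('e \<Rightarrow> 'g) \<Rightarrow> bool" where
  "finite_gain_graph \<Gamma> H \<psi> \<longleftrightarrow> fin_digraph H \<and> \<psi> \<in> arcs H \<rightarrow> carrier \<Gamma>"

definition arc_ends :: "('v, 'e) pre_digraph \<Rightarrow> 'e set \<Rightarrow> 'v set" where
  "arc_ends H F = tail H ` F \<union> head H ` F"

text \<open>
  Cycles ignore the reference orientation. The arc \<open>(e, True)\<close> stands for \<open>e\<close> traversed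
  forwards and \<open>(e, False)\<close> for \<open>e\<close> traversed backwards. The condition on \<open>map fst c\<close> only
  excludes the closed walks that go along an edge and straight back along the same edge.
\<close>

definition traversals :: "('v, 'e) pre_digraph \<Rightarrow> 'e set \<Rightarrow> ('v, 'e \<times> bool) pre_digraph" where
  "traversals H F =
     \<lparr>verts = arc_ends H F, arcs = F \<times> UNIV,
      tail = (\<lambda>(e, fwd). if fwd then tail H e else head H e),
      head = (\<lambda>(e, fwd). if fwd then head H e else tail H e)\<rparr>"

definition is_cycle :: "('v, 'e) pre_digraph \<Rightarrow> 'e set \<Rightarrow> ('e \<times> bool) list \<Rightarrow> bool" where
  "is_cycle H F c \<longleftrightarrow> pre_digraph.cycle (traversals H F) c \<and> distinct (map fst c)"

fun gain :: "('g, 'm) monoid_scheme \<Rightarrow> ('e \<Rightarrow> 'g) \<Rightarrow> ('e \<times> bool) list \<Rightarrow> 'g" where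
  "gain \<Gamma> \<psi> [] = \<one>\<^bsub>\<Gamma>\<^esub>"
| "gain \<Gamma> \<psi> ((e, fwd) # c) = (if fwd then \<psi> e else inv\<^bsub>\<Gamma>\<^esub> (\<psi> e)) \<otimes>\<^bsub>\<Gamma>\<^esub> gain \<Gamma> \<psi> c"

definition gain_subgroup ::
    "('g, 'm) monoid_scheme \<Rightarrow> ('v, 'e) pre_digraph \<Rightarrow> ('e \<Rightarrow> 'g) \<Rightarrow> 'e set \<Rightarrow> 'g set" where
  "gain_subgroup \<Gamma> H \<psi> F = generate \<Gamma> {gain \<Gamma> \<psi> c | c. is_cycle H F c}"

definition balanced ::
    "('g, 'm) monoid_scheme \<Rightarrow> ('v, 'e) pre_digraph \<Rightarrow> ('e \<Rightarrow> 'g) \<Rightarrow> 'e set \<Rightarrow> bool" where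
  "balanced \<Gamma> H \<psi> F \<longleftrightarrow> (\<forall>c. is_cycle H F c \<longrightarrow> gain \<Gamma> \<psi> c = \<one>\<^bsub>\<Gamma>\<^esub>)"

definition gain_sparse_2_3_2 ::
    "('g, 'm) monoid_scheme \<Rightarrow> ('v, 'e) pre_digraph \<Rightarrow> ('e \<Rightarrow> 'g) \<Rightarrow> 'e set \<Rightarrow> bool" where
  "gain_sparse_2_3_2 \<Gamma> H \<psi> E \<longleftrightarrow>
     (\<forall>F \<subseteq> E. F \<noteq> {} \<longrightarrow> balanced \<Gamma> H \<psi> F \<longrightarrow>
        int (card F) \<le> 2 * int (card (arc_ends H F)) - 3) \<and>
     (\<forall>F \<subseteq> E. F \<noteq> {} \<longrightarrow> int (card F) \<le> 2 * int (card (arc_ends H F)) - 2)"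

section \<open>Rotation groups in the plane\<close>

definition rotation :: "real \<Rightarrow> real^2^2" where
  "rotation \<theta> = vector [vector [cos \<theta>, - sin \<theta>], vector [sin \<theta>, cos \<theta>]]"

definition orthogonal_group :: "(real^2^2) monoid" where
  "orthogonal_group = \<lparr>carrier = {A. orthogonal_matrix A}, monoid.mult = (**), one = mat 1\<rparr>"

definition rotation_group :: "nat \<Rightarrow> (real^2^2) monoid" where
  "rotation_group k =
     orthogonal_group\<lparr>carrier := generate orthogonal_group {rotation (2 * pi / real k)}\<rparr>"

definition faithful_rep :: "('g, 'm) monoid_scheme \<Rightarrow> nat \<Rightarrow> ('g \<Rightarrow> real^2^2) \<Rightarrow> bool" where
  "faithful_rep \<Gamma> k \<tau> \<longleftrightarrow> \<tau> \<in> hom \<Gamma> (rotation_group k) \<and> inj_on \<tau> (carrier \<Gamma>)"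

section \<open>Covering graphs and regularity\<close>

text \<open>An edge of the covering graph is its set of end points, a singleton if the two ends
  coincide.\<close>

definition covering_edges ::
    "('g, 'm) monoid_scheme \<Rightarrow> ('v, 'e) pre_digraph \<Rightarrow> ('e \<Rightarrow> 'g) \<Rightarrow> ('g \<times> 'v) set set" where
  "covering_edges \<Gamma> H \<psi> =
     {{(g, tail H e), (g \<otimes>\<^bsub>\<Gamma>\<^esub> \<psi> e, head H e)} | g e. g \<in> carrier \<Gamma> \<and> e \<in> arcs H}"

definition covering_map :: "('g \<Rightarrow> real^2^2) \<Rightarrow> ('v \<Rightarrow> real^2) \<Rightarrow> 'g \<times> 'v \<Rightarrow> real^2" where
  "covering_map \<tau> p = (\<lambda>(g, v). \<tau> g *v p v)"

text \<open>The column \<open>(x, i)\<close> is the one of the \<open>i\<close>-th coordinate of the vertex \<open>x\<close>. For an edge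
  \<open>{u, v}\<close> the sum is \<open>p u - p v\<close> if \<open>x = u\<close> and \<open>p v - p u\<close> if \<open>x = v\<close>. It vanishes
  if \<open>u = v\<close>.\<close>

definition rigidity_matrix :: "('x \<Rightarrow> real^2) \<Rightarrow> 'x set \<Rightarrow> 'x \<times> 2 \<Rightarrow> real" where
  "rigidity_matrix p s = (\<lambda>(x, i). if x \<in> s then (\<Sum>y\<in>s. (p x - p y) $ i) else 0)"

definition regular ::
    "('g, 'm) monoid_scheme \<Rightarrow> ('g \<Rightarrow> real^2^2) \<Rightarrow> ('v, 'e) pre_digraph \<Rightarrow> ('e \<Rightarrow> 'g) \<Rightarrow>
     ('v \<Rightarrow> real^2) \<Rightarrow> bool" where
  "regular \<Gamma> \<tau> H \<psi> p \<longleftrightarrow>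
     (\<forall>q. matrix_rank (covering_edges \<Gamma> H \<psi>) (rigidity_matrix (covering_map \<tau> q))
        \<le> matrix_rank (covering_edges \<Gamma> H \<psi>) (rigidity_matrix (covering_map \<tau> p)))"

section \<open>Orbit rigidity matrices\<close>

text \<open>For a loop both summands contribute to the same two columns.\<close>

definition orbit_matrix ::
    "nat \<Rightarrow> (int \<Rightarrow> real^2^2) \<Rightarrow> int \<Rightarrow> ('v, 'e) pre_digraph \<Rightarrow> ('e \<Rightarrow> int) \<Rightarrow>
     ('v \<Rightarrow> real^2) \<Rightarrow> 'e \<Rightarrow> 'v \<times> 2 \<Rightarrow> complex" where
  "orbit_matrix k \<tau> j H \<psi> p e =
     (let u = tail H e; v = head H e; \<omega> = exp (2 * of_real pi * \<i> / of_nat k) in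
      (\<lambda>(x, i).
         (if x = u then of_real ((p u - \<tau> (\<psi> e) *v p v) $ i) else 0) +
         (if x = v then \<omega> powi (j * \<psi> e) *
            of_real ((p v - matrix_inv (\<tau> (\<psi> e)) *v p u) $ i) else 0)))"

end

theory Submission
  imports Defs
begin

text \<open>
  A subgroup of order two of the integers modulo \<open>k\<close> is \<open>{0, h}\<close> with \<open>k = 2 h\<close>. If all cycle gains of
  \<open>F\<close> lie in it, then there is a potential \<open>\<phi>\<close> on the vertices with \<open>\<psi> e\<close> congruent to
  \<open>\<phi> (head e) - \<phi> (tail e)\<close> modulo \<open>h\<close>. Since \<open>\<tau> h\<close> is the half turn and \<open>\<omega>\<close> raised to \<open>j h\<close> is \<open>-1\<close> for
  odd \<open>j\<close>, the two signs cancel, and twisting the two translations by \<open>\<phi>\<close> gives two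
  vectors in the kernel of the orbit matrix restricted to any subset of \<open>F\<close>. On a balanced
  subset the potential exists modulo \<open>k\<close>, and the twisted infinitesimal rotation is a third
  kernel vector. It is independent of the first two because otherwise the orbit matrix would have
  a zero row.
\<close>

section \<open>Potentials of gain graphs\<close>

lemma wf_traversals: "wf_digraph (traversals H F)"
  by unfold_locales (auto simp: traversals_def arc_ends_def)

text \<open>The edge set enters \<open>traversals\<close> only through \<open>verts\<close> and
  \<open>arcs\<close>, not through \<open>tail\<close> and \<open>head\<close>. Walks can therefore
  be moved between edge sets, as the induction over edges in \<open>potential_exists\<close>
  requires.\<close>

lemma cas_traversals: "pre_digraph.cas (traversals H F) = pre_digraph.cas (traversals H F')"
proof (intro ext)
  fix u p v
  show "pre_digraph.cas (traversals H F) u p v = pre_digraph.cas (traversals H F') u p v"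
    by (induction p arbitrary: u) (auto simp: pre_digraph.cas.simps traversals_def)
qed

lemma awalk_verts_traversals:
  "pre_digraph.awalk_verts (traversals H F) = pre_digraph.awalk_verts (traversals H F')"
proof (intro ext)
  fix u p
  show "pre_digraph.awalk_verts (traversals H F) u p = pre_digraph.awalk_verts (traversals H F') u p"
    by (induction p arbitrary: u) (auto simp: pre_digraph.awalk_verts.simps traversals_def)
qed

lemma is_cycle_mono:
  assumes "is_cycle H F c" "F \<subseteq> F'"
  shows "is_cycle H F' c"
proof -
  have "verts (traversals H F) \<subseteq> verts (traversals H F')"
    "arcs (traversals H F) \<subseteq> arcs (traversals H F')"
    using assms(2) by (auto simp: traversals_def arc_ends_def)
  with assms(1) show ?thesis
    unfolding is_cycle_def pre_digraph.cycle_def pre_digraph.awalk_def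
      cas_traversals[of H F F'] awalk_verts_traversals[of H F F'] by blast
qed

text \<open>The gain lifted to the integers, so that divisibility by the group order and by its half
  can be treated alike.\<close>

definition signed_sum :: "('e \<Rightarrow> int) \<Rightarrow> ('e \<times> bool) list \<Rightarrow> int" where
  "signed_sum \<psi> c = (\<Sum>(e, fwd)\<leftarrow>c. if fwd then \<psi> e else - \<psi> e)"

lemma gain_eq_signed_sum:
  assumes "\<psi> \<in> A \<rightarrow> carrier (integer_mod_group k)" "fst ` set c \<subseteq> A"
  shows "gain (integer_mod_group k) \<psi> c = signed_sum \<psi> c mod int k"
  using assms(2)
proof (induction c)
  case (Cons a c)
  obtain e b where a: "a = (e, b)" by fastforce
  have "\<psi> e \<in> carrier (integer_mod_group k)" using Cons.prems assms(1) a by auto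
  then show ?case using Cons a by (auto simp: signed_sum_def mod_simps)
qed (simp add: signed_sum_def)

lemma is_cycle_subset:
  assumes "is_cycle H F c"
  shows "fst ` set c \<subseteq> F"
  using assms by (auto simp: is_cycle_def pre_digraph.cycle_def pre_digraph.awalk_def traversals_def)

text \<open>If the edge of the first arc came back in either direction, its two ends, and with them
  the starting vertex, would occur again among the later vertices.\<close>

lemma distinct_edges_of_path:
  assumes "distinct (pre_digraph.awalk_verts (traversals H F) u p)"
    "pre_digraph.cas (traversals H F) u p v"
  shows "distinct (map fst p)"
  using assms
proof (induction p arbitrary: u)
  case (Cons a p)
  interpret wf_digraph "traversals H F" by (rule wf_traversals)
  obtain e b where a: "a = (e, b)" by fastforce
  let ?w = "head (traversals H F) a"
  have u: "u = tail (traversals H F) a" and cas: "cas ?w p v"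
    and notin: "u \<notin> set (awalk_verts ?w p)"
    using Cons.prems by auto
  have "e \<noteq> fst x" if x: "x \<in> set p" for x
  proof
    assume "e = fst x"
    have "tail (traversals H F) x \<in> set (awalk_verts ?w p)"
      "head (traversals H F) x \<in> set (awalk_verts ?w p)"
      subgoal using x by (subst awalk_verts_conv) auto
      subgoal using x by (subst awalk_verts_conv'[OF cas]) auto
      done
    moreover have "u \<in> {tail (traversals H F) x, head (traversals H F) x}"
      using \<open>e = fst x\<close> unfolding u a by (cases x) (auto simp: traversals_def)
    ultimately show False using notin by auto
  qed
  then show ?case using Cons cas a by auto
qed simp

text \<open>These are the fundamental cycles. The empty path is allowed and gives a loop.\<close>

lemma is_cycle_closing_edge:
  assumes "pre_digraph.cas (traversals H F) (head H e) p (tail H e)" "set p \<subseteq> F \<times> UNIV"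
    "distinct (pre_digraph.awalk_verts (traversals H F) (head H e) p)" "e \<notin> F"
  shows "is_cycle H (insert e F) ((e, True) # p)"
proof -
  have "distinct (map fst p)" using distinct_edges_of_path assms by metis
  moreover have "e \<notin> set (map fst p)" using assms by auto
  moreover have "pre_digraph.cas (traversals H (insert e F)) (head H e) p (tail H e)"
    "distinct (pre_digraph.awalk_verts (traversals H (insert e F)) (head H e) p)"
    using assms cas_traversals[of H F "insert e F"] awalk_verts_traversals[of H F "insert e F"]
    by metis+
  ultimately show ?thesis using assms(2)
    unfolding is_cycle_def pre_digraph.cycle_def pre_digraph.awalk_def
    by (auto simp: traversals_def arc_ends_def pre_digraph.cas.simps pre_digraph.awalk_verts.simps)
qed

text \<open>The potential differences telescope along the walk.\<close>

lemma signed_sum_walk: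
  assumes "pre_digraph.cas (traversals H F) u p v" "set p \<subseteq> F \<times> UNIV"
    "\<forall>e\<in>F. m dvd \<psi> e + \<phi> (tail H e) - \<phi> (head H e)"
  shows "m dvd signed_sum \<psi> p + \<phi> u - \<phi> v"
  using assms(1,2)
proof (induction p arbitrary: u)
  case (Cons a p)
  obtain e b where a: "a = (e, b)" by fastforce
  define w where "w = head (traversals H F) a"
  have u: "u = tail (traversals H F) a" and "pre_digraph.cas (traversals H F) w p v"
    using Cons.prems by (auto simp: pre_digraph.cas.simps w_def)
  then have "m dvd signed_sum \<psi> p + \<phi> w - \<phi> v" using Cons by auto
  moreover have "m dvd (if b then \<psi> e else - \<psi> e) + \<phi> u - \<phi> w"
  proof -
    have *: "m dvd \<psi> e + \<phi> (tail H e) - \<phi> (head H e)" using Cons.prems a assms(3) by auto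
    then have "m dvd - (\<psi> e + \<phi> (tail H e) - \<phi> (head H e))" by (simp only: dvd_minus_iff)
    with * show ?thesis by (auto simp: u w_def a traversals_def algebra_simps)
  qed
  ultimately have "m dvd (signed_sum \<psi> p + \<phi> w - \<phi> v) + ((if b then \<psi> e else - \<psi> e) + \<phi> u - \<phi> w)"
    by (rule dvd_add)
  then show ?case by (simp add: a signed_sum_def algebra_simps)
qed (simp add: signed_sum_def pre_digraph.cas.simps)

text \<open>Edges are added one at a time. If the new edge closes a cycle, the cycle condition shows
  that the old potential still fits. Otherwise the edge joins two components, and the potential on
  one of them can be shifted freely.\<close>

lemma potential_exists:
  fixes \<psi> :: "'e \<Rightarrow> int" and H :: "('v, 'e) pre_digraph"
  assumes "finite F" "\<And>c. is_cycle H F c \<Longrightarrow> m dvd signed_sum \<psi> c"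
  shows "\<exists>\<phi>. \<forall>e\<in>F. m dvd \<psi> e + \<phi> (tail H e) - \<phi> (head H e)"
  using assms
proof (induction F rule: finite_induct)
  case (insert e F)
  interpret wf_digraph "traversals H F" by (rule wf_traversals)
  obtain \<phi> where \<phi>: "\<forall>e\<in>F. m dvd \<psi> e + \<phi> (tail H e) - \<phi> (head H e)"
    using insert.IH insert.prems is_cycle_mono[of H F _ "insert e F"] by (metis subset_insertI)
  \<comment> \<open>The component of \<open>head H e\<close> with respect to the old edges.\<close>
  define C where "C = {x. \<exists>p. cas (head H e) p x \<and> set p \<subseteq> F \<times> UNIV}"
  show ?case
  proof (cases "tail H e \<in> C")
    case True
    then obtain q where q: "cas (head H e) q (tail H e)" "set q \<subseteq> F \<times> UNIV"
      by (auto simp: C_def)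
    obtain p where p: "cas (head H e) p (tail H e)" "set p \<subseteq> F \<times> UNIV"
      "distinct (awalk_verts (head H e) p)"
    \<comment> \<open>An \<open>awalk\<close> must start at a vertex of
      \<open>traversals H F\<close>, and \<open>head H e\<close> need not be one when
      \<open>q\<close> is empty, that is, when \<open>e\<close> is a loop.\<close>
    proof (cases "q = []")
      case True
      then show ?thesis using that[of "[]"] q by auto
    next
      case False
      then have "tail (traversals H F) (hd q) = head H e" using q(1) cas_simp[of q] by simp
      moreover have "hd q \<in> arcs (traversals H F)"
        using False q hd_in_set[of q] by (auto simp: traversals_def)
      ultimately have "awalk (head H e) q (tail H e)"
        using q tail_in_verts[of "hd q"] by (simp add: awalk_def) (simp add: traversals_def)
      then have "apath (head H e) (awalk_to_apath q) (tail H e)" by (rule apath_awalk_to_apath)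
      moreover have "arcs (traversals H F) = F \<times> UNIV" by (simp add: traversals_def)
      ultimately show ?thesis using that unfolding apath_def awalk_def by metis
    qed
    have "m dvd signed_sum \<psi> ((e, True) # p)"
      using is_cycle_closing_edge[OF p(1,2,3) insert.hyps(2)] insert.prems by blast
    moreover have "m dvd signed_sum \<psi> p + \<phi> (head H e) - \<phi> (tail H e)"
      using signed_sum_walk[OF p(1,2) \<phi>] .
    ultimately have "m dvd signed_sum \<psi> ((e, True) # p) -
        (signed_sum \<psi> p + \<phi> (head H e) - \<phi> (tail H e))" by (rule dvd_diff)
    then have "m dvd \<psi> e + \<phi> (tail H e) - \<phi> (head H e)"
      by (simp add: signed_sum_def algebra_simps)
    with \<phi> show ?thesis by auto
  next
    case False
    have walk_snoc: "cas u (p @ [a]) (head (traversals H F) a)"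
      if "cas u p (tail (traversals H F) a)" for u p a
      using that by (induction p arbitrary: u) auto
    have step: "head (traversals H F) a \<in> C"
      if "tail (traversals H F) a \<in> C" "a \<in> F \<times> UNIV" for a
    proof -
      obtain p where "cas (head H e) p (tail (traversals H F) a)" "set p \<subseteq> F \<times> UNIV"
        using \<open>tail (traversals H F) a \<in> C\<close> unfolding C_def by blast
      with walk_snoc \<open>a \<in> F \<times> UNIV\<close> show ?thesis
        unfolding C_def by (auto intro!: exI[of _ "p @ [a]"])
    qed
    have comp: "tail H f \<in> C \<longleftrightarrow> head H f \<in> C" if "f \<in> F" for f
      using step[of "(f, True)"] step[of "(f, False)"] that by (auto simp: traversals_def)
    have "head H e \<in> C" unfolding C_def by (auto intro!: exI[of _ "[]"])
    \<comment> \<open>The shift makes the defect of \<open>e\<close> exactly zero. Each old edge has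
      both ends in \<open>C\<close> or none, so its defect does not change.\<close>
    define \<phi>' where
      "\<phi>' x = (if x \<in> C then \<phi> x + (\<psi> e + \<phi> (tail H e) - \<phi> (head H e)) else \<phi> x)" for x
    have "\<forall>f\<in>insert e F. m dvd \<psi> f + \<phi>' (tail H f) - \<phi>' (head H f)"
      using False \<open>head H e \<in> C\<close> comp \<phi> by (auto simp: \<phi>'_def algebra_simps)
    then show ?thesis by blast
  qed
qed simp

section \<open>A bound for the number of independent rows\<close>

lemma sum_fun_apply: "(\<Sum>i\<in>I. f i) x = (\<Sum>i\<in>I. f i x)"
  for f :: "'i \<Rightarrow> 'a \<Rightarrow> 'b::comm_monoid_add"
  by (induction I rule: infinite_finite_induct) auto

text \<open>
  A set \<open>D\<close> of columns on which restriction is injective on the row space replaces the computation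
  of the dimension of a kernel.
\<close>

lemma card_rows_le:
  fixes M :: "'r \<Rightarrow> 'c \<Rightarrow> 'f::field"
  assumes indep: "row_independent R M" and "finite D"
    and zero: "\<And>r. r \<in> row_space.span (M ` R) \<Longrightarrow> \<forall>c\<in>D. r c = 0 \<Longrightarrow> r = 0"
  shows "card R \<le> card D"
proof -
  let ?s = "\<lambda>(c::'f) (r::'c \<Rightarrow> 'f) x. c * r x"
  have vs: "vector_space ?s" by (rule row_space.vector_space_axioms)
  \<comment> \<open>Truncation to the columns in \<open>D\<close>. It keeps the rows independent,
    and its image is spanned by the unit rows of \<open>D\<close>.\<close>
  define f where "f r = (\<lambda>c. if c \<in> D then r c else 0)" for r :: "'c \<Rightarrow> 'f"
  have lin: "Vector_Spaces.linear ?s ?s f"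
    unfolding Vector_Spaces.linear_iff using vs by (auto simp: f_def fun_eq_iff)
  have inj: "inj_on f (row_space.span (M ` R))"
  proof (rule inj_onI)
    fix r s assume rs: "r \<in> row_space.span (M ` R)" "s \<in> row_space.span (M ` R)" "f r = f s"
    have "r - s = 0"
    proof (rule zero)
      show "r - s \<in> row_space.span (M ` R)" using rs by (intro row_space.span_diff)
      show "\<forall>c\<in>D. (r - s) c = 0" using fun_cong[OF rs(3)] by (simp add: f_def) (metis diff_self)
    qed
    then show "r = s" by simp
  qed
  define unit :: "'c \<Rightarrow> 'c \<Rightarrow> 'f" where "unit c = (\<lambda>x. if x = c then 1 else 0)" for c
  have "f r \<in> row_space.span (unit ` D)" for r
  proof -
    have "f r = (\<Sum>c\<in>D. ?s (r c) (unit c))"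
      using \<open>finite D\<close>
      by (auto simp: fun_eq_iff f_def unit_def sum_fun_apply if_distrib cong: if_cong)
    moreover have "(\<Sum>c\<in>D. ?s (r c) (unit c)) \<in> row_space.span (unit ` D)"
    proof (rule row_space.span_sum)
      fix c assume "c \<in> D"
      then have "unit c \<in> row_space.span (unit ` D)" by (intro row_space.span_base imageI)
      then show "?s (r c) (unit c) \<in> row_space.span (unit ` D)" by (rule row_space.span_scale)
    qed
    ultimately show ?thesis by simp
  qed
  then have sub: "f ` M ` R \<subseteq> row_space.span (unit ` D)" by auto
  have indep': "row_space.independent (M ` R)" "inj_on M R"
    using indep by (auto simp: row_independent_def)
  have "row_space.independent (f ` M ` R)"
    using vector_space_pair.linear_independent_injective_image
      [OF vector_space_pair.intro[OF vs vs] lin indep'(1) inj] .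
  then have "card (f ` M ` R) \<le> card (unit ` D)"
    using row_space.independent_span_bound[OF finite_imageI[OF \<open>finite D\<close>] _ sub] by simp
  moreover have "card (f ` M ` R) = card R"
    using indep' inj_on_subset[OF inj row_space.span_superset]
    by (simp add: card_image)
  moreover have "card (unit ` D) \<le> card D" using \<open>finite D\<close> by (rule card_image_le)
  ultimately show ?thesis by simp
qed

text \<open>Here \<open>a\<close> and \<open>b\<close> hold the two coordinates of a column vector
  at each vertex. A kernel vector pairs to zero with every combination of the rows.\<close>

lemma functional_zero_on_span:
  fixes a b :: "'v \<Rightarrow> 'f::field" and M :: "'e \<Rightarrow> 'v \<times> 2 \<Rightarrow> 'f"
  assumes "r \<in> row_space.span (M ` F)"
    and "\<And>e. e \<in> F \<Longrightarrow> (\<Sum>x\<in>V. a x * M e (x, 1) + b x * M e (x, 2)) = 0"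
  shows "(\<Sum>x\<in>V. a x * r (x, 1) + b x * r (x, 2)) = 0"
  using assms(1)
proof (induction rule: row_space.span_induct_alt)
  case (step c r s)
  have "(\<Sum>x\<in>V. a x * (c * r (x, 1) + s (x, 1)) + b x * (c * r (x, 2) + s (x, 2))) =
      c * (\<Sum>x\<in>V. a x * r (x, 1) + b x * r (x, 2)) + (\<Sum>x\<in>V. a x * s (x, 1) + b x * s (x, 2))"
    by (simp add: sum_distrib_left sum.distrib algebra_simps)
  with step assms(2) show ?case by auto
qed simp

lemma zero_outside_on_span:
  fixes M :: "'e \<Rightarrow> 'c \<Rightarrow> 'f::field"
  assumes "r \<in> row_space.span (M ` F)" "\<And>e. e \<in> F \<Longrightarrow> M e c = 0"
  shows "r c = 0"
  using assms by (induction rule: row_space.span_induct_alt) auto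

section \<open>Representations by rotations\<close>

lemma rotation_mult: "rotation a ** rotation b = rotation (a + b)"
  by (simp add: rotation_def vec_eq_iff forall_2 matrix_matrix_mult_def sum_2 cos_add sin_add)

lemma rotation_0: "rotation 0 = mat 1"
  by (simp add: rotation_def vec_eq_iff forall_2 mat_def)

lemma rotation_eq_iff: "rotation a = rotation b \<longleftrightarrow> cis a = cis b"
  by (auto simp: rotation_def vec_eq_iff forall_2 complex_eq_iff)

lemma rotation_mult_vec:
  "(rotation \<theta> *v x) $ 1 = cos \<theta> * x $ 1 - sin \<theta> * x $ 2"
  "(rotation \<theta> *v x) $ 2 = sin \<theta> * x $ 1 + cos \<theta> * x $ 2"
  by (simp_all add: rotation_def matrix_vector_mult_def sum_2)

lemma matrix_inv_rotation: "matrix_inv (rotation \<theta>) = rotation (- \<theta>)"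
proof -
  have inv: "rotation \<theta> ** rotation (- \<theta>) = mat 1 \<and> rotation (- \<theta>) ** rotation \<theta> = mat 1"
    by (simp add: rotation_mult rotation_0)
  then have "rotation \<theta> ** matrix_inv (rotation \<theta>) = mat 1"
    unfolding matrix_inv_def by (rule someI2) simp
  with inv show ?thesis by (metis matrix_mul_assoc matrix_mul_lid matrix_mul_rid)
qed

lemma rotation_group_elem:
  assumes "A \<in> carrier (rotation_group k)"
  shows "\<exists>\<theta>. A = rotation \<theta>"
proof -
  interpret monoid orthogonal_group
    by (rule monoidI)
      (auto simp: orthogonal_group_def orthogonal_matrix_mul matrix_mul_assoc orthogonal_matrix_id)
  have orth: "rotation \<theta> \<in> carrier orthogonal_group" for \<theta>
  proof -
    have "transpose (rotation \<theta>) = rotation (- \<theta>)"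
      by (simp add: rotation_def vec_eq_iff forall_2 transpose_def)
    then show ?thesis
      by (simp add: orthogonal_group_def orthogonal_matrix_def rotation_mult rotation_0)
  qed
  have "A \<in> generate orthogonal_group {rotation (2 * pi / real k)}"
    using assms by (simp add: rotation_group_def)
  then show ?thesis
  proof (induction rule: generate.induct)
    case one
    show ?case by (auto simp: orthogonal_group_def rotation_0 intro!: exI[of _ 0])
  next
    case (inv h)
    have "rotation (- (2 * pi / real k)) = inv\<^bsub>orthogonal_group\<^esub> rotation (2 * pi / real k)"
      by (rule inv_unique'[OF orth orth])
        (auto simp: orthogonal_group_def rotation_mult rotation_0)
    with inv show ?case by (metis singletonD)
  next
    case (eng h1 h2)
    then show ?case by (auto simp: orthogonal_group_def rotation_mult)
  qed auto
qed

text \<open>The residue 1 generates the group, so an angle \<alpha> of \<open>\<tau> 1\<close>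
  determines \<tau>. The formula concerns the representatives below \<open>k\<close>, which are the
  possible gains.\<close>

lemma faithful_rep_cyclic:
  assumes rep: "faithful_rep (integer_mod_group k) k \<tau>" and "k > 1"
  obtains \<alpha> where "\<And>g. 0 \<le> g \<Longrightarrow> g < int k \<Longrightarrow> \<tau> g = rotation (of_int g * \<alpha>)"
proof -
  have carr: "carrier (integer_mod_group k) = {0..<int k}"
    using \<open>k > 1\<close> by (simp add: carrier_integer_mod_group)
  have hom: "\<tau> ((g + h) mod int k) = \<tau> g ** \<tau> h" if "g \<in> {0..<int k}" "h \<in> {0..<int k}" for g h
    using rep that hom_mult[of \<tau> "integer_mod_group k" "rotation_group k" g h]
    by (simp add: faithful_rep_def carr rotation_group_def orthogonal_group_def)
  have rot: "\<exists>\<theta>. \<tau> g = rotation \<theta>" if "g \<in> {0..<int k}" for g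
    using rep that hom_in_carrier[of \<tau> "integer_mod_group k" "rotation_group k" g]
    by (intro rotation_group_elem[of _ k]) (simp add: faithful_rep_def carr)
  obtain \<alpha> where \<alpha>: "\<tau> 1 = rotation \<alpha>" using rot[of 1] \<open>k > 1\<close> by auto
  obtain \<beta> where \<beta>: "\<tau> 0 = rotation \<beta>" using rot[of 0] \<open>k > 1\<close> by auto
  \<comment> \<open>An idempotent rotation is the identity, because \<open>cis \<beta>\<close> can
    be cancelled.\<close>
  have "\<tau> 0 = \<tau> 0 ** \<tau> 0" using hom[of 0 0] \<open>k > 1\<close> by simp
  then have "cis \<beta> = cis \<beta> * cis \<beta>"
    unfolding \<beta> rotation_mult rotation_eq_iff cis_mult .
  then have "\<tau> 0 = rotation 0" by (simp add: \<beta> rotation_eq_iff)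
  have "int n < int k \<Longrightarrow> \<tau> (int n) = rotation (of_int (int n) * \<alpha>)" for n
  proof (induction n)
    case (Suc n)
    then have "\<tau> (int (Suc n)) = \<tau> (int n) ** \<tau> 1"
      using hom[of "int n" 1] \<open>k > 1\<close> by (simp add: add.commute)
    with Suc show ?case by (simp add: \<alpha> rotation_mult algebra_simps)
  qed (simp add: \<open>\<tau> 0 = rotation 0\<close>)
  then show ?thesis by (intro that[of \<alpha>]) (metis nonneg_int_cases)
qed

text \<open>The element \<open>h\<close> has order two, so \<open>cis (of_int h * \<alpha>)\<close>
  squares to 1. Injectivity of \<tau> excludes the value 1 itself.\<close>

lemma faithful_rep_half_turn:
  assumes rep: "faithful_rep (integer_mod_group k) k \<tau>" and k: "int k = 2 * h" "k > 1"
    and \<tau>: "\<And>g. 0 \<le> g \<Longrightarrow> g < int k \<Longrightarrow> \<tau> g = rotation (of_int g * \<alpha>)"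
  shows "cis (of_int h * \<alpha>) = -1"
proof -
  have carr: "carrier (integer_mod_group k) = {0..<int k}"
    using \<open>k > 1\<close> by (simp add: carrier_integer_mod_group)
  have h: "h \<in> {0..<int k}" "0 \<in> {0..<int k}" "h \<noteq> 0" using k by auto
  have "\<tau> ((h + h) mod int k) = \<tau> h ** \<tau> h"
    using rep h hom_mult[of \<tau> "integer_mod_group k" "rotation_group k" h h]
    by (simp add: faithful_rep_def carr rotation_group_def orthogonal_group_def)
  then have "cis (of_int h * \<alpha>) * cis (of_int h * \<alpha>) = 1"
    using h \<tau>[of h] \<tau>[of 0] k by (simp add: rotation_mult rotation_eq_iff cis_mult)
  moreover have "\<tau> h \<noteq> \<tau> 0"
    using rep h by (auto simp: faithful_rep_def carr inj_on_def)
  then have "cis (of_int h * \<alpha>) \<noteq> 1"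
    using h \<tau>[of h] \<tau>[of 0] by (simp add: rotation_eq_iff)
  ultimately show ?thesis by (simp add: square_eq_1_iff)
qed

lemma cis_eq_1_dvd:
  assumes "cis (of_int m * \<beta>) = 1" "m dvd a"
  shows "cis (of_int a * \<beta>) = 1"
proof -
  obtain n where "a = m * n" using assms(2) by blast
  then have "cis (of_int a * \<beta>) = cis (of_int m * \<beta>) powi n"
    by (simp add: cis_power_int mult_ac)
  with assms(1) show ?thesis by simp
qed

text \<open>The nonzero element \<open>h\<close> of the subgroup lies strictly between 0 and
  \<open>k\<close>, and its double lies in the subgroup again. The double is not \<open>h\<close>,
  so it is 0 modulo \<open>k\<close>, and the only multiple of \<open>k\<close> in that range is
  \<open>k\<close>.\<close>

lemma generate_of_order_two:
  assumes "k > 1" "X \<subseteq> carrier (integer_mod_group k)"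
    and card: "card (generate (integer_mod_group k) X) = 2"
  obtains h where "int k = 2 * h" "generate (integer_mod_group k) X = {0, h}"
proof -
  let ?G = "generate (integer_mod_group k) X"
  have "0 \<in> ?G" using generate.one[of "integer_mod_group k" X] by simp
  moreover obtain x y where "?G = {x, y}" "x \<noteq> y" using card by (auto simp: card_2_iff)
  ultimately obtain h where G: "?G = {0, h}" "h \<noteq> 0" by (metis insert_commute insertE singletonD)
  have "h \<in> carrier (integer_mod_group k)"
    using group.generate_in_carrier[OF group_integer_mod_group assms(2), of h] G by blast
  then have h: "0 < h" "h < int k" using G(2) \<open>k > 1\<close> by (auto simp: carrier_integer_mod_group)
  have "(h + h) mod int k \<in> ?G"
    using generate.eng[of h "integer_mod_group k" X h] G by simp
  then have "(h + h) mod int k = 0 \<or> (h + h) mod int k = h" using G by auto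
  then have "int k = 2 * h"
  proof
    assume "(h + h) mod int k = 0"
    then obtain c where c: "h + h = int k * c" by (auto simp: mod_eq_0_iff_dvd)
    then have "0 < int k * c" "int k * c < int k * 2" using h by linarith+
    then have "c = 1" using h by (simp add: zero_less_mult_iff)
    with c show ?thesis by simp
  next
    assume "(h + h) mod int k = h"
    then have "int k dvd h" using h by (metis add_diff_cancel_right' mod_eq_dvd_iff mod_pos_pos_trivial less_imp_le)
    with h show ?thesis using zdvd_not_zless by blast
  qed
  with G that show ?thesis by blast
qed

section \<open>Kernel vectors of the orbit matrix\<close>

lemma orbit_matrix_rotation:
  assumes "\<tau> (\<psi> e) = rotation \<theta>"
  shows "orbit_matrix k \<tau> j H \<psi> p e (x, i) =
    (if x = tail H e then of_real ((p (tail H e) - rotation \<theta> *v p (head H e)) $ i) else 0) +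
    (if x = head H e then cis (of_int (\<psi> e) * (2 * pi * of_int j / real k)) *
      of_real ((p (head H e) - rotation (- \<theta>) *v p (tail H e)) $ i) else 0)"
proof -
  have "exp (2 * of_real pi * \<i> / of_nat k) = cis (2 * pi / real k)"
    by (simp add: cis_conv_exp mult_ac)
  then have "exp (2 * of_real pi * \<i> / of_nat k) powi (j * \<psi> e) =
      cis (of_int (\<psi> e) * (2 * pi * of_int j / real k))"
    by (simp add: cis_power_int mult_ac)
  with assms show ?thesis by (simp add: orbit_matrix_def Let_def matrix_inv_rotation)
qed

lemma orbit_row_functional:
  assumes "\<tau> (\<psi> e) = rotation \<theta>" "finite V" "tail H e \<in> V" "head H e \<in> V"
  shows "(\<Sum>x\<in>V. a x * orbit_matrix k \<tau> j H \<psi> p e (x, 1) + b x * orbit_matrix k \<tau> j H \<psi> p e (x, 2)) =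
    (a (tail H e) * of_real ((p (tail H e) - rotation \<theta> *v p (head H e)) $ 1) +
     b (tail H e) * of_real ((p (tail H e) - rotation \<theta> *v p (head H e)) $ 2)) +
    cis (of_int (\<psi> e) * (2 * pi * of_int j / real k)) *
    (a (head H e) * of_real ((p (head H e) - rotation (- \<theta>) *v p (tail H e)) $ 1) +
     b (head H e) * of_real ((p (head H e) - rotation (- \<theta>) *v p (tail H e)) $ 2))"
  using assms(2-4)
  by (simp add: orbit_matrix_rotation[where \<theta> = \<theta> and \<tau> = \<tau> and \<psi> = \<psi> and e = e, OF assms(1)] distrib_left sum.distrib
      if_distrib[of "(*) _"] mult_ac cong: if_cong)

text \<open>
  The translations are taken along the common eigenvectors \<open>(1, \<plusminus>\<i>)\<close> of all rotations, so that
  the twist by the potential is a scalar weight \<open>\<kappa>\<close>.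
\<close>

lemma translation_annihilates:
  fixes s :: complex
  assumes \<theta>: "\<tau> (\<psi> e) = rotation \<theta>" and V: "finite V" "tail H e \<in> V" "head H e \<in> V"
    and s: "s\<^sup>2 = 1"
    and \<kappa>: "cis (of_int (\<psi> e) * (2 * pi * of_int j / real k)) * \<kappa> (head H e) =
      \<kappa> (tail H e) * (of_real (cos \<theta>) + \<i> * s * of_real (sin \<theta>))"
  shows "(\<Sum>x\<in>V. \<kappa> x * orbit_matrix k \<tau> j H \<psi> p e (x, 1) +
      \<i> * s * \<kappa> x * orbit_matrix k \<tau> j H \<psi> p e (x, 2)) = 0"
proof -
  let ?W = "cis (of_int (\<psi> e) * (2 * pi * of_int j / real k))"
  define c :: complex where "c = of_real (cos \<theta>)"
  define S :: complex where "S = of_real (sin \<theta>)"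
  define u1 :: complex where "u1 = of_real (p (tail H e) $ 1)"
  define u2 :: complex where "u2 = of_real (p (tail H e) $ 2)"
  define v1 :: complex where "v1 = of_real (p (head H e) $ 1)"
  define v2 :: complex where "v2 = of_real (p (head H e) $ 2)"
  define D where "D = (u1 - (c * v1 - S * v2)) + \<i> * s * (u2 - (S * v1 + c * v2))"
  define D' where "D' = (v1 - (c * u1 + S * u2)) + \<i> * s * (v2 - (- S * u1 + c * u2))"
  have cS: "c\<^sup>2 + S\<^sup>2 = 1"
    unfolding c_def S_def of_real_power[symmetric] of_real_add[symmetric] by simp
  have "\<i>\<^sup>2 = (-1::complex)" by simp
  \<comment> \<open>Pairing with the vector (1, \<open>\<i> * s\<close>) turns the rotation by
    \<theta> into multiplication by m = \<open>c + \<i> * s * S\<close>, whose inverse is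
    \<open>c - \<i> * s * S\<close>. If x and y are the pairings with the positions of tail and
    head, then \<open>D\<close> is x - m y and \<open>D'\<close> is y - x / m.\<close>
  have D: "D + (c + \<i> * s * S) * D' = 0"
    unfolding D_def D'_def using cS s \<open>\<i>\<^sup>2 = (-1::complex)\<close> by algebra
  have "(\<Sum>x\<in>V. \<kappa> x * orbit_matrix k \<tau> j H \<psi> p e (x, 1) +
      \<i> * s * \<kappa> x * orbit_matrix k \<tau> j H \<psi> p e (x, 2)) =
      \<kappa> (tail H e) * D + (?W * \<kappa> (head H e)) * D'"
    unfolding orbit_row_functional[where \<theta> = \<theta> and \<tau> = \<tau> and \<psi> = \<psi> and e = e, OF \<theta> V] D_def D'_def
      c_def S_def u1_def u2_def v1_def v2_def
    by (simp add: rotation_mult_vec algebra_simps)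
  also have "\<dots> = \<kappa> (tail H e) * (D + (c + \<i> * s * S) * D')"
    unfolding \<kappa> c_def S_def by (simp add: algebra_simps)
  finally show ?thesis by (simp add: D)
qed

text \<open>The kernel vector is the position turned by a quarter turn and weighted by \<kappa>, so
  pairing with it is a cross product with the position. With u and v the positions of tail and head
  and R the rotation by \<theta>, the products of u with R v and of v with the inverse of R applied
  to u are opposite, because rotations preserve cross products.\<close>

lemma rotation_annihilates:
  assumes \<theta>: "\<tau> (\<psi> e) = rotation \<theta>" and V: "finite V" "tail H e \<in> V" "head H e \<in> V"
    and \<kappa>: "cis (of_int (\<psi> e) * (2 * pi * of_int j / real k)) * \<kappa> (head H e) = \<kappa> (tail H e)"
  shows "(\<Sum>x\<in>V. - \<kappa> x * of_real (p x $ 2) * orbit_matrix k \<tau> j H \<psi> p e (x, 1) +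
      \<kappa> x * of_real (p x $ 1) * orbit_matrix k \<tau> j H \<psi> p e (x, 2)) = 0"
proof -
  let ?W = "cis (of_int (\<psi> e) * (2 * pi * of_int j / real k))"
  define c :: complex where "c = of_real (cos \<theta>)"
  define S :: complex where "S = of_real (sin \<theta>)"
  define u1 :: complex where "u1 = of_real (p (tail H e) $ 1)"
  define u2 :: complex where "u2 = of_real (p (tail H e) $ 2)"
  define v1 :: complex where "v1 = of_real (p (head H e) $ 1)"
  define v2 :: complex where "v2 = of_real (p (head H e) $ 2)"
  define D where "D = - u2 * (u1 - (c * v1 - S * v2)) + u1 * (u2 - (S * v1 + c * v2))"
  define D' where "D' = - v2 * (v1 - (c * u1 + S * u2)) + v1 * (v2 - (- S * u1 + c * u2))"
  have D: "D + D' = 0"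
    unfolding D_def D'_def by algebra
  have "(\<Sum>x\<in>V. - \<kappa> x * of_real (p x $ 2) * orbit_matrix k \<tau> j H \<psi> p e (x, 1) +
      \<kappa> x * of_real (p x $ 1) * orbit_matrix k \<tau> j H \<psi> p e (x, 2)) =
      \<kappa> (tail H e) * D + (?W * \<kappa> (head H e)) * D'"
    unfolding orbit_row_functional[where \<theta> = \<theta> and \<tau> = \<tau> and \<psi> = \<psi> and e = e, OF \<theta> V] D_def D'_def
      c_def S_def u1_def u2_def v1_def v2_def
    by (simp add: rotation_mult_vec algebra_simps)
  also have "\<dots> = \<kappa> (tail H e) * (D + D')"
    unfolding \<kappa> by (simp add: algebra_simps)
  finally show ?thesis by (simp add: D)
qed

text \<open>The angle \<beta> is the eigenvalue angle minus the angle of the twist. Multiplied by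
  \<open>h\<close>, both parts become half turns modulo full turns, so
  \<open>cis (of_int x * \<beta>)\<close> depends on the integer x only modulo \<open>h\<close>. A
  potential modulo \<open>h\<close> is therefore enough.\<close>

lemma translation_weight:
  assumes s: "s = 1 \<or> s = -1" and dvd: "h dvd g + \<phi>u - \<phi>v"
    and h: "cis (of_int h * \<alpha>) = -1" "int k = 2 * h" "k > 0" and "odd j"
  defines "\<beta> \<equiv> s * \<alpha> - 2 * pi * of_int j / real k"
  shows "cis (of_int g * (2 * pi * of_int j / real k)) * cis (of_int \<phi>v * \<beta>) =
    cis (of_int \<phi>u * \<beta>) *
      (of_real (cos (of_int g * \<alpha>)) + \<i> * of_real s * of_real (sin (of_int g * \<alpha>)))"
proof -
  have "real k = of_int (int k)" by simp
  then have k: "real k = 2 * of_int h" "h \<noteq> 0" using h(2,3) by auto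
  have "cis (s * (of_int h * \<alpha>)) = -1"
    using s h(1) by (auto simp: complex_eq_iff)
  moreover have "cis (- (pi * of_int j)) = cis pi powi (- j)"
    by (simp add: cis_power_int mult.commute del: cis_pi)
  then have "cis (- (pi * of_int j)) = -1"
    using \<open>odd j\<close> by (simp add: power_int_minus_left_odd)
  ultimately have "cis (s * (of_int h * \<alpha>) + - (pi * of_int j)) = 1"
    by (simp only: cis_mult[symmetric]) simp
  moreover have "of_int h * \<beta> = s * (of_int h * \<alpha>) + - (pi * of_int j)"
    using k by (simp add: \<beta>_def field_simps)
  ultimately have "cis (of_int h * \<beta>) = 1" by simp
  then have "cis (of_int (g + \<phi>u - \<phi>v) * \<beta>) = 1" using dvd by (rule cis_eq_1_dvd)
  then have "cis (of_int \<phi>v * \<beta>) = cis (of_int (g + \<phi>u - \<phi>v) * \<beta>) * cis (of_int \<phi>v * \<beta>)"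
    by simp
  also have "\<dots> = cis (of_int g * \<beta>) * cis (of_int \<phi>u * \<beta>)"
    by (simp add: cis_mult algebra_simps)
  finally have "cis (of_int g * (2 * pi * of_int j / real k)) * cis (of_int \<phi>v * \<beta>) =
      cis (of_int \<phi>u * \<beta>) * cis (of_int g * (2 * pi * of_int j / real k) + of_int g * \<beta>)"
    by (simp only: cis_mult[symmetric] mult_ac)
  also have "of_int g * (2 * pi * of_int j / real k) + of_int g * \<beta> = s * (of_int g * \<alpha>)"
    by (simp add: \<beta>_def algebra_simps)
  also have "cis (s * (of_int g * \<alpha>)) =
      of_real (cos (of_int g * \<alpha>)) + \<i> * of_real s * of_real (sin (of_int g * \<alpha>))"
    using s by (auto simp: complex_eq_iff)
  finally show ?thesis .
qed

text \<open>No eigenvalue compensates the twist here, and periodicity is available modulo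
  \<open>k\<close>. This is why the third kernel vector is tied to balanced sets.\<close>

lemma rotation_weight:
  fixes j :: int
  assumes "int k dvd g + \<phi>u - \<phi>v" "k > 0"
  defines "\<beta> \<equiv> - (2 * pi * of_int j / real k)"
  shows "cis (of_int g * (2 * pi * of_int j / real k)) * cis (of_int \<phi>v * \<beta>) = cis (of_int \<phi>u * \<beta>)"
proof -
  have "cis (of_int (int k) * \<beta>) = 1"
    using assms(2) by (simp add: \<beta>_def complex_eq_iff mult.commute[of "of_int j"])
  then have "cis (of_int (g + \<phi>u - \<phi>v) * \<beta>) = 1" using assms(1) by (rule cis_eq_1_dvd)
  then have "cis (of_int \<phi>u * \<beta>) = cis (of_int \<phi>u * \<beta>) / cis (of_int (g + \<phi>u - \<phi>v) * \<beta>)"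
    by simp
  also have "\<dots> = cis (of_int g * (2 * pi * of_int j / real k)) * cis (of_int \<phi>v * \<beta>)"
    by (simp add: cis_mult cis_divide \<beta>_def algebra_simps)
  finally show ?thesis by simp
qed

section \<open>Row counts from two and from three kernel vectors\<close>

context
  fixes k :: nat and j h :: int and \<tau> :: "int \<Rightarrow> real^2^2" and \<alpha> :: real
    and H :: "('v, 'e) pre_digraph" and \<psi> :: "'e \<Rightarrow> int" and p :: "'v \<Rightarrow> real^2"
    and F :: "'e set"
  assumes k: "int k = 2 * h" "k > 0" and odd_j: "odd j"
    and half: "cis (of_int h * \<alpha>) = -1"
    and \<tau>: "\<And>e. e \<in> F \<Longrightarrow> \<tau> (\<psi> e) = rotation (of_int (\<psi> e) * \<alpha>)"
    and fin: "finite F" and nonempty: "F \<noteq> {}"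
    and indep: "row_independent F (orbit_matrix k \<tau> j H \<psi> p)"
begin

private abbreviation (input) "V \<equiv> arc_ends H F"
private abbreviation (input) "M \<equiv> orbit_matrix k \<tau> j H \<psi> p"

private lemma finite_V: "finite V"
  using fin by (simp add: arc_ends_def)

private lemma ends_in_V: "e \<in> F \<Longrightarrow> tail H e \<in> V" "e \<in> F \<Longrightarrow> head H e \<in> V"
  by (simp_all add: arc_ends_def)

private lemma span_support: "r \<in> row_space.span (M ` F) \<Longrightarrow> x \<notin> V \<Longrightarrow> r (x, i) = 0"
  by (rule zero_outside_on_span[where M = M and F = F])
    (use ends_in_V in \<open>auto simp: orbit_matrix_def Let_def\<close>)

private lemma span_translation:
  fixes s :: real
  assumes "r \<in> row_space.span (M ` F)" "s = 1 \<or> s = -1"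
    and \<phi>: "\<forall>e\<in>F. h dvd \<psi> e + \<phi> (tail H e) - \<phi> (head H e)"
  defines "\<beta> \<equiv> s * \<alpha> - 2 * pi * of_int j / real k"
  shows "(\<Sum>x\<in>V. cis (of_int (\<phi> x) * \<beta>) * r (x, 1) +
    \<i> * of_real s * cis (of_int (\<phi> x) * \<beta>) * r (x, 2)) = 0"
  using assms(1)
proof (rule functional_zero_on_span)
  fix e assume e: "e \<in> F"
  have "(of_real s :: complex)\<^sup>2 = 1" using assms(2) by auto
  moreover have "cis (of_int (\<psi> e) * (2 * pi * of_int j / real k)) * cis (of_int (\<phi> (head H e)) * \<beta>) =
      cis (of_int (\<phi> (tail H e)) * \<beta>) * (of_real (cos (of_int (\<psi> e) * \<alpha>)) +
        \<i> * of_real s * of_real (sin (of_int (\<psi> e) * \<alpha>)))"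
    unfolding \<beta>_def using assms(2) \<phi> e half k odd_j by (intro translation_weight) auto
  ultimately show "(\<Sum>x\<in>V. cis (of_int (\<phi> x) * \<beta>) * M e (x, 1) +
    \<i> * of_real s * cis (of_int (\<phi> x) * \<beta>) * M e (x, 2)) = 0"
    by (intro translation_annihilates[where \<theta> = "of_int (\<psi> e) * \<alpha>"])
      (use e \<tau> finite_V ends_in_V in auto)
qed

text \<open>The two columns of one vertex \<open>x0\<close> are dropped. At \<open>x0\<close> the
  two translations are nonzero multiples of (1, \<open>\<i>\<close>) and (1, \<open>-\<i>\<close>),
  which are independent, so a combination of rows that vanishes in all other columns vanishes at
  \<open>x0\<close> too.\<close>

lemma card_rows_le_of_potential:
  assumes \<phi>: "\<forall>e\<in>F. h dvd \<psi> e + \<phi> (tail H e) - \<phi> (head H e)"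
  shows "int (card F) \<le> 2 * int (card (arc_ends H F)) - 2"
proof -
  obtain x0 where x0: "x0 \<in> V" using nonempty ends_in_V by blast
  define D where "D = (V - {x0}) \<times> (UNIV :: 2 set)"
  have "card F \<le> card D"
  proof (rule card_rows_le[OF indep])
    show "finite D" using finite_V by (simp add: D_def)
    fix r assume r: "r \<in> row_space.span (M ` F)" and D: "\<forall>c\<in>D. r c = 0"
    have eq: "r (x0, 1) + \<i> * of_real s * r (x0, 2) = 0" if s: "s = 1 \<or> s = -1" for s :: real
    proof -
      define \<kappa> where "\<kappa> x = cis (of_int (\<phi> x) * (s * \<alpha> - 2 * pi * of_int j / real k))" for x
      have "0 = (\<Sum>x\<in>V. \<kappa> x * r (x, 1) + \<i> * of_real s * \<kappa> x * r (x, 2))"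
        unfolding \<kappa>_def using span_translation[OF r s \<phi>] by simp
      also have "\<dots> = (\<Sum>x\<in>{x0}. \<kappa> x * r (x, 1) + \<i> * of_real s * \<kappa> x * r (x, 2))"
        by (rule sum.mono_neutral_right) (use finite_V x0 D in \<open>auto simp: D_def\<close>)
      also have "\<dots> = \<kappa> x0 * (r (x0, 1) + \<i> * of_real s * r (x0, 2))"
        by (simp add: algebra_simps)
      finally show ?thesis by (simp add: \<kappa>_def)
    qed
    have "r (x0, 1) = 0" "r (x0, 2) = 0" using eq[of 1] eq[of "-1"] by auto
    then have "r (x, i) = 0" for x i
      using span_support[OF r, of x i] D exhaust_2[of i] by (cases "x = x0") (auto simp: D_def)
    then show "r = 0" by (auto simp: fun_eq_iff)
  qed
  also have "card D = 2 * (card V - 1)"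
    using finite_V x0 by (simp add: D_def card_cartesian_product)
  moreover have "card V > 0" using finite_V x0 by (auto simp: card_gt_0_iff)
  ultimately show ?thesis by simp
qed

text \<open>Three columns at the ends \<open>u\<close> and \<open>v\<close> of one edge are dropped,
  both of \<open>u\<close> and one of \<open>v\<close>. For a combination of rows supported at the
  two ends, the translations express its part at \<open>u\<close> through its part at
  \<open>v\<close>, and the rotation then forces the latter to be parallel to the edge vector
  \<open>w\<close>.\<close>

lemma card_rows_le_of_balanced_potential:
  assumes range: "\<psi> ` F \<subseteq> {0..<int k}"
    and \<phi>: "\<forall>e\<in>F. int k dvd \<psi> e + \<phi> (tail H e) - \<phi> (head H e)"
  shows "int (card F) \<le> 2 * int (card (arc_ends H F)) - 3"
proof -
  obtain e where e: "e \<in> F" using nonempty by blast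
  define u v \<theta> where "u = tail H e" and "v = head H e" and "\<theta> = of_int (\<psi> e) * \<alpha>"
  define w where "w = p v - rotation (- \<theta>) *v p u"
  note uv = ends_in_V[OF e, folded u_def v_def]
  have \<tau>e: "\<tau> (\<psi> e) = rotation \<theta>" using \<tau>[OF e] by (simp add: \<theta>_def)
  \<comment> \<open>If \<open>w\<close> were zero, the row of \<open>e\<close> would be zero,
    contrary to independence.\<close>
  have "w \<noteq> 0"
  proof
    assume "w = 0"
    then have zero: "p u - rotation \<theta> *v p v = 0"
      by (simp add: w_def matrix_vector_mul_assoc rotation_mult rotation_0)
    have "M e (x, i) = 0" for x i
      unfolding orbit_matrix_rotation[where \<tau> = \<tau> and \<psi> = \<psi> and e = e and H = H and p = p,
          OF \<tau>e, folded u_def v_def, folded w_def] zero \<open>w = 0\<close> by simp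
    then have "M e = 0" by (auto simp: fun_eq_iff)
    then have "0 \<in> M ` F" using e by force
    with indep show False by (auto simp: row_independent_def row_space.dependent_zero)
  qed
  \<comment> \<open>On a loop the potential cancels, so the gain is 0 modulo \<open>k\<close>, hence
    0, and \<open>w\<close> would vanish.\<close>
  have "u \<noteq> v"
  proof
    assume "u = v"
    then have "int k dvd \<psi> e" using \<phi> e by (auto simp: u_def v_def)
    moreover have "0 \<le> \<psi> e" "\<psi> e < int k" using range e by auto
    ultimately have "\<psi> e = 0" using zdvd_not_zless by (metis order_le_less)
    with \<open>u = v\<close> \<open>w \<noteq> 0\<close> show False by (simp add: w_def \<theta>_def rotation_0)
  qed
  \<comment> \<open>The column of \<open>v\<close> that stays in \<open>D\<close> is one in which
    \<open>w\<close> is nonzero. A vector parallel to \<open>w\<close> that vanishes there is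
    zero.\<close>
  define i :: 2 where "i = (if w $ 2 \<noteq> 0 then 1 else 2)"
  define X where "X = {(u, 1), (u, 2), (v, i)}"
  define D where "D = V \<times> (UNIV :: 2 set) - X"
  have "card F \<le> card D"
  proof (rule card_rows_le[OF indep])
    show "finite D" using finite_V by (simp add: D_def)
    fix r assume r: "r \<in> row_space.span (M ` F)" and D: "\<forall>c\<in>D. r c = 0"
    have D0: "r (x, i) = 0" if "x \<in> V" "x \<noteq> u" "x \<noteq> v" for x i
      using D that by (auto simp: D_def X_def)
    define W where "W = cis (of_int (\<psi> e) * (2 * pi * of_int j / real k))"
    define c S :: complex where "c = of_real (cos \<theta>)" and "S = of_real (sin \<theta>)"
    have collapse: "(\<Sum>x\<in>V. a x * r (x, 1) + b x * r (x, 2)) =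
        (a u * r (u, 1) + b u * r (u, 2)) + (a v * r (v, 1) + b v * r (v, 2))"
      for a b :: "'v \<Rightarrow> complex"
    proof -
      have "(\<Sum>x\<in>V. a x * r (x, 1) + b x * r (x, 2)) =
          (\<Sum>x\<in>{u, v}. a x * r (x, 1) + b x * r (x, 2))"
        by (rule sum.mono_neutral_right) (use finite_V uv D0 in auto)
      then show ?thesis using \<open>u \<noteq> v\<close> by simp
    qed
    have dvd: "int k dvd \<psi> e + \<phi> u - \<phi> v" using \<phi> e by (simp add: u_def v_def)
    then have dvd': "h dvd \<psi> e + \<phi> u - \<phi> v" using k(1) by (metis dvd_mult_right)
    have \<phi>': "\<forall>e\<in>F. h dvd \<psi> e + \<phi> (tail H e) - \<phi> (head H e)"
      using \<phi> k(1) by (metis dvd_mult_right)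
    \<comment> \<open>Multiplying the kernel relation by \<open>W\<close> makes
      \<open>\<kappa> u\<close> a common factor, and it is a unit.\<close>
    have transl: "W * (r (u, 1) + \<i> * of_real s * r (u, 2)) +
        (c + \<i> * of_real s * S) * (r (v, 1) + \<i> * of_real s * r (v, 2)) = 0"
      if s: "s = 1 \<or> s = -1" for s :: real
    proof -
      define \<kappa> where "\<kappa> x = cis (of_int (\<phi> x) * (s * \<alpha> - 2 * pi * of_int j / real k))" for x
      have 1: "(\<kappa> u * r (u, 1) + \<i> * of_real s * \<kappa> u * r (u, 2)) +
          (\<kappa> v * r (v, 1) + \<i> * of_real s * \<kappa> v * r (v, 2)) = 0"
        using span_translation[OF r s \<phi>'] unfolding \<kappa>_def collapse .
      have 2: "W * \<kappa> v = \<kappa> u * (c + \<i> * of_real s * S)"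
        unfolding \<kappa>_def W_def c_def S_def \<theta>_def
        using translation_weight[OF s dvd' half k odd_j] .
      have "\<kappa> u * (W * (r (u, 1) + \<i> * of_real s * r (u, 2)) +
          (c + \<i> * of_real s * S) * (r (v, 1) + \<i> * of_real s * r (v, 2))) = 0"
        using 1 2 by algebra
      then show ?thesis by (simp add: \<kappa>_def)
    qed
    define \<mu> where "\<mu> x = cis (of_int (\<phi> x) * (- (2 * pi * of_int j / real k)))" for x
    have "(\<Sum>x\<in>V. - \<mu> x * of_real (p x $ 2) * r (x, 1) + \<mu> x * of_real (p x $ 1) * r (x, 2)) = 0"
      using r
    proof (rule functional_zero_on_span)
      fix e assume e: "e \<in> F"
      have "cis (of_int (\<psi> e) * (2 * pi * of_int j / real k)) * \<mu> (head H e) = \<mu> (tail H e)"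
        unfolding \<mu>_def using \<phi> e k by (intro rotation_weight) auto
      then show "(\<Sum>x\<in>V. - \<mu> x * of_real (p x $ 2) * M e (x, 1) +
          \<mu> x * of_real (p x $ 1) * M e (x, 2)) = 0"
        by (intro rotation_annihilates[where \<theta> = "of_int (\<psi> e) * \<alpha>"])
          (use e \<tau> finite_V ends_in_V in auto)
    qed
    then have 1: "- \<mu> u * of_real (p u $ 2) * r (u, 1) + \<mu> u * of_real (p u $ 1) * r (u, 2) +
        (- \<mu> v * of_real (p v $ 2) * r (v, 1) + \<mu> v * of_real (p v $ 1) * r (v, 2)) = 0"
      unfolding collapse .
    have 2: "W * \<mu> v = \<mu> u"
      unfolding \<mu>_def W_def using rotation_weight[OF dvd k(2)] .
    have "\<mu> u * (W * (- of_real (p u $ 2) * r (u, 1) + of_real (p u $ 1) * r (u, 2)) +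
        (- of_real (p v $ 2) * r (v, 1) + of_real (p v $ 1) * r (v, 2))) = 0"
      using 1 2 by algebra
    then have rot: "W * (- of_real (p u $ 2) * r (u, 1) + of_real (p u $ 1) * r (u, 2)) +
        (- of_real (p v $ 2) * r (v, 1) + of_real (p v $ 1) * r (v, 2)) = 0"
      by (simp add: \<mu>_def)
    have "\<i>\<^sup>2 = (-1::complex)" by simp
    have "W * (r (u, 1) + \<i> * r (u, 2)) + (c + \<i> * S) * (r (v, 1) + \<i> * r (v, 2)) = 0"
      "W * (r (u, 1) - \<i> * r (u, 2)) + (c - \<i> * S) * (r (v, 1) - \<i> * r (v, 2)) = 0"
      using transl[of 1] transl[of "-1"] by simp_all
    \<comment> \<open>Sum and difference of the two relations separate the coordinates:
      \<open>W\<close> times the part of \<open>r\<close> at \<open>u\<close> is minus the part at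
      \<open>v\<close> rotated by \<theta>.\<close>
    then have "2 * (W * r (u, 1) + (c * r (v, 1) - S * r (v, 2))) = 0"
      "2 * (\<i> * (W * r (u, 2) + (S * r (v, 1) + c * r (v, 2)))) = 0"
      using \<open>\<i>\<^sup>2 = (-1::complex)\<close> by algebra+
    then have Wr: "W * r (u, 1) + (c * r (v, 1) - S * r (v, 2)) = 0"
      "W * r (u, 2) + (S * r (v, 1) + c * r (v, 2)) = 0"
      unfolding mult_eq_0_iff by simp_all
    have w: "of_real (w $ 1) = of_real (p v $ 1) - (c * of_real (p u $ 1) + S * of_real (p u $ 2))"
      "of_real (w $ 2) = of_real (p v $ 2) - (- S * of_real (p u $ 1) + c * of_real (p u $ 2))"
      by (simp_all add: w_def rotation_mult_vec c_def S_def)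
    \<comment> \<open>Substituting this into \<open>rot\<close> and moving the rotation to the other
      factor of the cross product leaves the cross product of \<open>w\<close> with the part of
      \<open>r\<close> at \<open>v\<close>.\<close>
    have ortho: "of_real (w $ 1) * r (v, 2) - of_real (w $ 2) * r (v, 1) = 0"
      unfolding w using rot Wr by algebra
    have rv: "r (v, 1) = 0 \<and> r (v, 2) = 0"
    proof (cases "w $ 2 = 0")
      case True
      then have "w $ 1 \<noteq> 0" using \<open>w \<noteq> 0\<close> by (auto simp: vec_eq_iff forall_2)
      moreover have "r (v, 1) = 0"
        using D uv True \<open>u \<noteq> v\<close> by (auto simp: D_def X_def i_def)
      ultimately show ?thesis using ortho by simp
    next
      case False
      then have "r (v, 2) = 0"
        using D uv \<open>u \<noteq> v\<close> by (auto simp: D_def X_def i_def)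
      with False show ?thesis using ortho by simp
    qed
    with Wr have ru: "r (u, 1) = 0" "r (u, 2) = 0" by (auto simp: W_def)
    have "r (x, i) = 0" for x i
      using span_support[OF r, of x i] D0[of x i] rv ru exhaust_2[of i] by metis
    then show "r = 0" by (auto simp: fun_eq_iff)
  qed
  moreover have "card X = 3" "X \<subseteq> V \<times> UNIV"
    using \<open>u \<noteq> v\<close> uv by (auto simp: X_def)
  \<comment> \<open>The inequality ensures that the subtraction of natural numbers is not
    truncated.\<close>
  then have "card D = 2 * card V - 3" "3 \<le> 2 * card V"
    using finite_V card_mono[of "V \<times> (UNIV :: 2 set)" X]
    by (simp_all add: D_def card_Diff_subset finite_subset card_cartesian_product)
  ultimately show ?thesis by simp
qed

end

section \<open>Sparsity of edge sets whose gain group has order two\<close>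

theorem lemma6p13:
  fixes k :: nat and j :: int
    and \<tau> :: "int \<Rightarrow> real^2^2"
    and H :: "('v, 'e) pre_digraph" and \<psi> :: "'e \<Rightarrow> int"
    and p :: "'v \<Rightarrow> real^2"
  assumes "k \<ge> 4"
    and "faithful_rep (integer_mod_group k) k \<tau>"
    and "finite_gain_graph (integer_mod_group k) H \<psi>"
    and "regular (integer_mod_group k) \<tau> H \<psi> p"
    and "odd j" and "1 \<le> j" and "j < int k"
    and "row_independent (arcs H) (orbit_matrix k \<tau> j H \<psi> p)"
  shows "\<forall>F \<subseteq> arcs H.
    (integer_mod_group k)\<lparr>carrier := gain_subgroup (integer_mod_group k) H \<psi> F\<rparr>
      \<cong> integer_mod_group 2 \<longrightarrow>
    gain_sparse_2_3_2 (integer_mod_group k) H \<psi> F"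
proof (intro allI impI)
  fix F assume F: "F \<subseteq> arcs H"
    and iso: "(integer_mod_group k)\<lparr>carrier := gain_subgroup (integer_mod_group k) H \<psi> F\<rparr>
      \<cong> integer_mod_group 2"
  have "k > 1" "k > 0" using assms(1) by auto
  have \<psi>: "\<psi> \<in> arcs H \<rightarrow> carrier (integer_mod_group k)" and "finite (arcs H)"
    using assms(3) fin_digraph.finite_arcs by (auto simp: finite_gain_graph_def)
  have gain: "gain (integer_mod_group k) \<psi> c = signed_sum \<psi> c mod int k" if "is_cycle H F c" for c
    using gain_eq_signed_sum[OF \<psi>] is_cycle_subset[OF that] F by blast
  \<comment> \<open>The isomorphism enters through the order of the gain subgroup.\<close>
  have "card (gain_subgroup (integer_mod_group k) H \<psi> F) = card (carrier (integer_mod_group 2))"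
    using iso by (auto simp: is_iso_def iso_def intro: bij_betw_same_card)
  then have card: "card (generate (integer_mod_group k)
      {gain (integer_mod_group k) \<psi> c |c. is_cycle H F c}) = 2"
    by (simp add: gain_subgroup_def carrier_integer_mod_group)
  have carr: "{gain (integer_mod_group k) \<psi> c |c. is_cycle H F c} \<subseteq> carrier (integer_mod_group k)"
    using gain \<open>k > 1\<close> by (auto simp: carrier_integer_mod_group)
  obtain h where h: "int k = 2 * h"
      "generate (integer_mod_group k) {gain (integer_mod_group k) \<psi> c |c. is_cycle H F c} = {0, h}"
    using generate_of_order_two[OF \<open>k > 1\<close> carr card] by blast
  have cyc: "h dvd signed_sum \<psi> c" if c: "is_cycle H F c" for c
  proof -
    have "gain (integer_mod_group k) \<psi> c \<in> {0, h}"
      unfolding h(2)[symmetric] using c by (intro generate.incl) blast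
    \<comment> \<open>Since \<open>h\<close> divides \<open>k\<close>, reduction modulo
      \<open>k\<close> preserves divisibility by \<open>h\<close>.\<close>
    then have "h dvd signed_sum \<psi> c mod int k" using gain[OF c] by auto
    then show ?thesis using h(1) by (metis dvd_mod_iff dvd_triv_right)
  qed
  obtain \<alpha> where \<alpha>: "\<And>g. 0 \<le> g \<Longrightarrow> g < int k \<Longrightarrow> \<tau> g = rotation (of_int g * \<alpha>)"
    using faithful_rep_cyclic[OF assms(2) \<open>k > 1\<close>] by blast
  have half: "cis (of_int h * \<alpha>) = -1"
    by (rule faithful_rep_half_turn[OF assms(2) h(1) \<open>k > 1\<close>]) (rule \<alpha>)
  have sub: "row_independent F' (orbit_matrix k \<tau> j H \<psi> p)" "finite F'" "\<psi> ` F' \<subseteq> {0..<int k}"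
    "\<And>e. e \<in> F' \<Longrightarrow> \<tau> (\<psi> e) = rotation (of_int (\<psi> e) * \<alpha>)" if "F' \<subseteq> F" for F'
  proof -
    have F': "F' \<subseteq> arcs H" using that F by blast
    show "finite F'" using F' \<open>finite (arcs H)\<close> finite_subset by blast
    show "row_independent F' (orbit_matrix k \<tau> j H \<psi> p)"
      using assms(8) F' row_space.independent_mono[OF _ image_mono[OF F']]
      by (auto simp: row_independent_def intro: inj_on_subset)
    show range: "\<psi> ` F' \<subseteq> {0..<int k}"
      using \<psi> F' \<open>k > 1\<close> by (auto simp: carrier_integer_mod_group)
    show "\<And>e. e \<in> F' \<Longrightarrow> \<tau> (\<psi> e) = rotation (of_int (\<psi> e) * \<alpha>)"
      using range by (intro \<alpha>) auto
  qed
  show "gain_sparse_2_3_2 (integer_mod_group k) H \<psi> F"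
    unfolding gain_sparse_2_3_2_def
  proof (intro conjI allI impI)
    fix F' assume F': "F' \<subseteq> F" "F' \<noteq> {}" and bal: "balanced (integer_mod_group k) H \<psi> F'"
    have "int k dvd signed_sum \<psi> c" if "is_cycle H F' c" for c
      using bal that gain[OF is_cycle_mono[OF that F'(1)]] by (auto simp: balanced_def)
    then obtain \<phi> where \<phi>: "\<forall>e\<in>F'. int k dvd \<psi> e + \<phi> (tail H e) - \<phi> (head H e)"
      using potential_exists[OF sub(2)[OF F'(1)]] by metis
    show "int (card F') \<le> 2 * int (card (arc_ends H F')) - 3"
      by (intro card_rows_le_of_balanced_potential[where \<tau> = \<tau> and \<alpha> = \<alpha> and \<psi> = \<psi>,
            OF h(1) \<open>k > 0\<close> assms(5) half])
        (fact sub[OF F'(1)] F'(2) \<phi>)+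
  next
    fix F' assume F': "F' \<subseteq> F" "F' \<noteq> {}"
    \<comment> \<open>Cycles of \<open>F'\<close> are cycles of \<open>F\<close>, so their signed
      sums are divisible by \<open>h\<close>.\<close>
    obtain \<phi> where \<phi>: "\<forall>e\<in>F'. h dvd \<psi> e + \<phi> (tail H e) - \<phi> (head H e)"
      using potential_exists[OF sub(2)[OF F'(1)]] cyc is_cycle_mono[OF _ F'(1)] by metis
    show "int (card F') \<le> 2 * int (card (arc_ends H F')) - 2"
      by (intro card_rows_le_of_potential[where \<tau> = \<tau> and \<alpha> = \<alpha> and \<psi> = \<psi>,
            OF h(1) \<open>k > 0\<close> assms(5) half])
        (fact sub[OF F'(1)] F'(2) \<phi>)+
  qed
qed

end
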